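(* Let $\Gamma=\mathbb{Z}/b\mathbb{Z}$ with $b=|\Gamma|\ge 1$, and let $n,k$ be positive integers. Let $d_b(n)$ be the smallest positive divisor of $n$ such that $n/d_b(n)$ is coprime with $b$. Then the number of cycles in the factor $F_k(\iota_n)$ produced by the incremented cycling register rule $\iota_n$ is $$|F_k(\iota_n)|=\frac{k\,\bigl(\operatorname{lcm}(k,b\,d_b(n)):n\bigr)}{\operatorname{lcm}(k,b\,d_b(n))\,n}\sum_{(\operatorname{lcm}(k,b\,d_b(n)):n)\mid d\mid n}\varphi(n/d)\,b^d,$$ where the sum is over all positive integers $d$ that are multiples of $(\operatorname{lcm}(k,b\,d_b(n)):n)$ and divide $n$.
   Context: $(x:y)$ denotes the greatest common divisor of the integers $x,y$; $\varphi$ is Euler's totient function. The incremented cycling register rule is $\iota_n:\Gamma^n\to\Gamma^n$, $\iota_n(a_0a_1\cdots a_{n-1})=a_1\cdots a_{n-1}(a_0+1)$, with addition in $\mathbb{Z}/b\mathbb{Z}$. $F_k(\iota_n)$ is the set of orbits (cycles) of the bijection $A_k(\iota_n):\Gamma^n\times\mathbb{Z}/k\mathbb{Z}\to\Gamma^n\times\mathbb{Z}/k\mathbb{Z}$, $(s,i)\mapsto(\iota_n(s),i+1)$. *)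

theory Defs
  imports Complex_Main "HOL-Number_Theory.Totient" "HOL-Combinatorics.Orbits"
begin

text \<open>
  The alphabet \<open>\<Gamma> = \<int>/b\<int>\<close> and the group \<open>\<int>/k\<int>\<close> are represented by the least residues
  \<open>{..<b}\<close> and \<open>{..<k}\<close>, with addition modulo \<open>b\<close> and \<open>k\<close>, respectively.
\<close>

definition words :: "nat \<Rightarrow> nat \<Rightarrow> nat list set"
  where "words b n = {s. length s = n \<and> set s \<subseteq> {..<b}}"

text \<open>Intended for nonempty words only; \<open>n\<close> is the length of the argument.\<close>

definition incremented_cycling :: "nat \<Rightarrow> nat list \<Rightarrow> nat list"  (\<open>\<iota>\<close>)
  where "\<iota> b s = tl s @ [(hd s + 1) mod b]"

definition augmented_rule :: "nat \<Rightarrow> ('s \<Rightarrow> 's) \<Rightarrow> 's \<times> nat \<Rightarrow> 's \<times> nat"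
  where "augmented_rule k f = (\<lambda>(s, i). (f s, (i + 1) mod k))"

text \<open>
  The library's \<^const>\<open>orbit\<close> collects the iterates with positive exponent; since
  the augmented rule permutes the finite set \<open>S \<times> {..<k}\<close> whenever \<open>f\<close> permutes the
  finite set \<open>S\<close>, these are the cycles of the permutation.
\<close>

definition factor :: "'s set \<Rightarrow> nat \<Rightarrow> ('s \<Rightarrow> 's) \<Rightarrow> ('s \<times> nat) set set"
  where "factor S k f = orbit (augmented_rule k f) ` (S \<times> {..<k})"

definition least_codivisor :: "nat \<Rightarrow> nat \<Rightarrow> nat"
  where "least_codivisor b n = (LEAST d. 0 < d \<and> d dvd n \<and> coprime (n div d) b)"

lemma in_set_tlD: "x \<in> set (tl xs) \<Longrightarrow> x \<in> set xs"
  by (cases xs) auto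

lemma finite_words: "finite (words b n)"
  unfolding words_def using finite_lists_length_eq[of "{..<b}" n] by (simp add: conj_commute)

lemma bij_betw_incremented_cycling:
  assumes "0 < b" "0 < n"
  shows "bij_betw (\<iota> b) (words b n) (words b n)"
proof -
  have maps: "\<iota> b ` words b n \<subseteq> words b n"
    using assms by (auto simp: words_def incremented_cycling_def dest!: in_set_tlD)
  have "inj_on (\<iota> b) (words b n)"
  proof (rule inj_onI)
    fix s t assume st: "s \<in> words b n" "t \<in> words b n" and eq: "\<iota> b s = \<iota> b t"
    from st assms obtain x xs y ys where [simp]: "s = x # xs" "t = y # ys"
      by (cases s; cases t) (auto simp: words_def)
    show "s = t"
      using st eq by (auto simp: words_def incremented_cycling_def mod_Suc split: if_splits)
  qed
  with maps show ?thesis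
    by (simp add: bij_betw_def endo_inj_surj finite_words)
qed

lemma bij_betw_augmented_rule:
  assumes "0 < k" "finite S" "bij_betw f S S"
  shows "bij_betw (augmented_rule k f) (S \<times> {..<k}) (S \<times> {..<k})"
proof -
  have maps: "augmented_rule k f ` (S \<times> {..<k}) \<subseteq> S \<times> {..<k}"
    using assms by (auto simp: augmented_rule_def bij_betw_def)
  have "inj_on (augmented_rule k f) (S \<times> {..<k})"
    using assms by (auto simp: augmented_rule_def bij_betw_def mod_Suc intro!: inj_onI
        dest: inj_onD split: if_splits)
  with maps assms show ?thesis
    by (simp add: bij_betw_def endo_inj_surj)
qed

end

theory Submission
  imports Defs
begin

text \<open>
  By Burnside's lemma for the cyclic group generated by the augmented rule, the number of cycles
  is the average number of fixed points over a period \<open>N\<close> of the rule.  Its \<open>t\<close>-th power moves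
  every pair \<open>(s, i)\<close> unless \<open>k\<close> divides \<open>t\<close>, and then it fixes the pairs with
  \<open>\<iota>\<^sup>t s = s\<close> (\<open>card_factor\<close>).

  Iterating \<open>\<iota>\<close> on a word slides a window of length \<open>n\<close> along an infinite sequence \<open>f\<close> with
  \<open>f (i + n) = f i + 1\<close> in \<open>\<int>/b\<int>\<close>, so \<open>\<iota>\<^sup>t\<close> fixes the word iff also \<open>f (i + t) = f i\<close>.  With
  \<open>g = gcd n t\<close> and Bezout coefficients \<open>n x = t y + g\<close>, the two laws together give
  \<open>f (i + g) = f i + x\<close>.  They contradict each other unless \<open>b g\<close> divides \<open>t\<close>, because
  \<open>f (i + n t / g)\<close> is both \<open>f i + t / g\<close> and \<open>f i\<close>; otherwise they are equivalent to this single
  law, and the first \<open>g\<close> letters are free.  So \<open>\<iota>\<^sup>t\<close> fixes \<open>b\<^sup>g\<close> words or none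
  (\<open>card_fixed_words\<close>).

  The divisibility condition on \<open>t\<close> is \<open>b d\<^sub>b(n) dvd t\<close> in disguise
  (\<open>mult_gcd_dvd_iff_least_codivisor\<close>).  Hence only the multiples \<open>t = D j\<close> of
  \<open>D = lcm k (b d\<^sub>b(n))\<close> contribute.  With \<open>h = gcd D n\<close> and \<open>m = n / h\<close> the period \<open>N\<close> can be taken
  to be \<open>D m = lcm D n\<close>, so that \<open>j\<close> runs from \<open>1\<close> to \<open>m\<close>, and \<open>gcd n (D j) = h gcd m j\<close>.  Sorting
  the \<open>j\<close> by \<open>e = gcd m j\<close> yields the sum of \<open>\<phi>(m / e) b\<^sup>h\<^sup>e\<close> over \<open>e dvd m\<close>, which is the sum in
  the theorem with \<open>d = h e\<close>.
\<close>


section \<open>Counting the cycles of a map of finite order\<close>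

lemma multiples_up_to_eq_image:
  fixes D m :: nat
  assumes "0 < D"
  shows "{t \<in> {0<..D * m}. D dvd t} = (*) D ` {0<..m}"
  using assms by (auto simp: dvd_def)

text \<open>
  The iterates of \<open>x\<close> are distinct up to the first return time, which is therefore the size of the
  orbit.
\<close>

lemma funpow_fixes_iff_card_orbit_dvd:
  assumes "x \<in> orbit f x"
  shows "(f ^^ t) x = x \<longleftrightarrow> card (orbit f x) dvd t"
proof -
  define p where "p = funpow_dist1 f x x"
  have inj: "inj_on (\<lambda>i. (f ^^ i) x) {0..<p}"
    unfolding p_def by (rule inj_on_funpow_dist1[OF assms])
  have "orbit f x = (\<lambda>i. (f ^^ i) x) ` {0..<p}"
    unfolding p_def by (rule orbit_conv_funpow_dist1[OF assms])
  then have card: "card (orbit f x) = p"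
    using inj by (simp add: card_image)
  have "(f ^^ p) x = x"
    unfolding p_def by (rule funpow_dist1_prop[OF assms])
  then have "(f ^^ t) x = (f ^^ (t mod p)) x"
    by (simp add: funpow_mod_eq)
  also have "\<dots> = x \<longleftrightarrow> t mod p = 0"
    using inj_onD[OF inj, of "t mod p" 0] by (auto simp: p_def)
  finally show ?thesis
    by (simp add: card dvd_eq_mod_eq_0)
qed

text \<open>
  Double counting: a point in an orbit of size \<open>p\<close> is fixed by \<open>N / p\<close> of the powers, so every orbit
  contributes \<open>N\<close> to the sum.
\<close>

lemma burnside_funpow:
  assumes "finite X" and "f ` X \<subseteq> X" and "0 < N"
    and period: "\<And>x. x \<in> X \<Longrightarrow> (f ^^ N) x = x"
  shows "N * card (orbit f ` X) = (\<Sum>t\<in>{0<..N}. card {x \<in> X. (f ^^ t) x = x})"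
proof -
  have self: "x \<in> orbit f x" if "x \<in> X" for x
    using period[OF that] \<open>0 < N\<close> by (auto simp: orbit_altdef intro!: exI[of _ N])
  have sub: "orbit f x \<subseteq> X" if "x \<in> X" for x
  proof
    fix y assume "y \<in> orbit f x"
    then show "y \<in> X"
      using that assms(2) by induct auto
  qed
  define c where "c x = card {t \<in> {0<..N}. (f ^^ t) x = x}" for x
  have orbit_sum: "(\<Sum>x | x \<in> X \<and> orbit f x = C. c x) = N" if "C \<in> orbit f ` X" for C
  proof -
    obtain x where x: "x \<in> X" "C = orbit f x"
      using \<open>C \<in> orbit f ` X\<close> by auto
    define p where "p = card C"
    have "p dvd N"
      using funpow_fixes_iff_card_orbit_dvd[OF self] period x by (auto simp: p_def)
    then obtain q where q: "N = p * q" ..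
    have "0 < p"
      using q \<open>0 < N\<close> by (cases p) auto
    have cyc: "cyclic_on f C"
      using cyclic_on_singleI self x by metis
    have "{y. y \<in> X \<and> orbit f y = C} = C"
    proof (intro equalityI subsetI)
      fix y assume "y \<in> {y. y \<in> X \<and> orbit f y = C}"
      then show "y \<in> C"
        using self[of y] by simp
    next
      fix y assume "y \<in> C"
      then show "y \<in> {y. y \<in> X \<and> orbit f y = C}"
        using sub[OF x(1)] orbit_cyclic_eq3[OF cyc] x(2) by blast
    qed
    moreover have "c y = q" if "y \<in> C" for y
    proof -
      have "orbit f y = C"
        using orbit_cyclic_eq3[OF cyc that] .
      then have "{t \<in> {0<..N}. (f ^^ t) y = y} = {t \<in> {0<..p * q}. p dvd t}"
        using funpow_fixes_iff_card_orbit_dvd[of y f] that by (auto simp: q p_def)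
      also have "card \<dots> = q"
        unfolding multiples_up_to_eq_image[OF \<open>0 < p\<close>]
        using \<open>0 < p\<close> by (simp add: card_image inj_on_def)
      finally show ?thesis
        by (simp add: c_def)
    qed
    ultimately show ?thesis
      by (simp add: q p_def)
  qed
  have "(\<Sum>t\<in>{0<..N}. card {x \<in> X. (f ^^ t) x = x}) = (\<Sum>x\<in>X. c x)"
    unfolding c_def by (rule sum_multicount_gen) (use assms in auto)
  also have "\<dots> = (\<Sum>C\<in>orbit f ` X. \<Sum>x | x \<in> X \<and> orbit f x = C. c x)"
    by (rule sum.image_gen[OF \<open>finite X\<close>])
  also have "\<dots> = N * card (orbit f ` X)"
    using orbit_sum by simp
  finally show ?thesis ..
qed

lemma augmented_rule_funpow:
  assumes "i < k"
  shows "(augmented_rule k f ^^ t) (s, i) = ((f ^^ t) s, (i + t) mod k)"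
  by (induct t) (use assms in \<open>auto simp: augmented_rule_def mod_simps\<close>)

text \<open>
  The second component returns to its start exactly at the multiples of \<open>k\<close>; at these times all
  \<open>k\<close> of its values are possible for a fixed point, which accounts for the factor \<open>k\<close>.
\<close>

lemma card_factor:
  assumes "0 < k" "finite S" "f ` S \<subseteq> S" "0 < N" "k dvd N"
    and period: "\<And>s. s \<in> S \<Longrightarrow> (f ^^ N) s = s"
  shows "N * card (factor S k f) =
    k * (\<Sum>t | t \<in> {0<..N} \<and> k dvd t. card {s \<in> S. (f ^^ t) s = s})"
proof -
  let ?A = "augmented_rule k f"
  have shift: "(i + t) mod k = i \<longleftrightarrow> k dvd t" if "i < k" for i t
    using mod_eq_dvd_iff_nat[of i "i + t" k] that by auto
  have "N * card (factor S k f) = (\<Sum>t\<in>{0<..N}. card {x \<in> S \<times> {..<k}. (?A ^^ t) x = x})"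
    unfolding factor_def
  proof (rule burnside_funpow)
    show "?A ` (S \<times> {..<k}) \<subseteq> S \<times> {..<k}"
      using assms by (auto simp: augmented_rule_def)
  next
    fix x assume "x \<in> S \<times> {..<k}"
    then show "(?A ^^ N) x = x"
      using period shift \<open>k dvd N\<close> by (cases x) (simp add: augmented_rule_funpow)
  qed (use assms in auto)
  also have "\<dots> = (\<Sum>t\<in>{0<..N}. if k dvd t then k * card {s \<in> S. (f ^^ t) s = s} else 0)"
  proof (rule sum.cong)
    fix t
    have "{x \<in> S \<times> {..<k}. (?A ^^ t) x = x} =
        (if k dvd t then {s \<in> S. (f ^^ t) s = s} \<times> {..<k} else {})"
      using shift by (auto simp: augmented_rule_funpow)
    then show "card {x \<in> S \<times> {..<k}. (?A ^^ t) x = x} =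
        (if k dvd t then k * card {s \<in> S. (f ^^ t) s = s} else 0)"
      by (simp add: card_cartesian_product)
  qed simp
  also have "\<dots> = k * (\<Sum>t | t \<in> {0<..N} \<and> k dvd t. card {s \<in> S. (f ^^ t) s = s})"
    by (simp add: sum.If_cases sum_distrib_left Int_def)
  finally show ?thesis .
qed


section \<open>Words as sequences\<close>

text \<open>
  One definition with a variable increment covers all three laws that occur: \<open>\<iota>\<close> produces period
  \<open>n\<close> with increment \<open>1\<close>, a fixed point of its \<open>t\<close>-th power has period \<open>t\<close> with increment \<open>0\<close>,
  and the two combine to period \<open>gcd n t\<close> with a Bezout coefficient as increment.
\<close>

definition quasi_periodic :: "nat \<Rightarrow> nat \<Rightarrow> nat \<Rightarrow> (nat \<Rightarrow> nat) set"
  where "quasi_periodic b m c = {f. (\<forall>i. f i < b) \<and> (\<forall>i. f (i + m) = (f i + c) mod b)}"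

definition unroll :: "nat \<Rightarrow> nat \<Rightarrow> nat \<Rightarrow> nat list \<Rightarrow> nat \<Rightarrow> nat"
  where "unroll b m c w i = (w ! (i mod m) + c * (i div m)) mod b"

lemma quasi_periodic_add_mult:
  assumes "f \<in> quasi_periodic b m c"
  shows "f (i + m * j) = (f i + c * j) mod b"
proof (induct j)
  case 0
  then show ?case
    using assms by (simp add: quasi_periodic_def)
next
  case (Suc j)
  have "f (i + m * Suc j) = f ((i + m * j) + m)"
    by (simp add: algebra_simps)
  also have "\<dots> = (f (i + m * j) + c) mod b"
    using assms by (simp add: quasi_periodic_def)
  also have "\<dots> = (f i + c * Suc j) mod b"
    by (simp add: Suc mod_add_left_eq add.assoc add.commute[of c])
  finally show ?case .
qed

text \<open>
  A quasi-periodic sequence is determined by its first \<open>m\<close> values, and these are arbitrary.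
\<close>

lemma bij_betw_unroll:
  assumes "0 < b" "0 < m"
  shows "bij_betw (unroll b m c) (words b m) (quasi_periodic b m c)"
proof (rule bij_betw_byWitness[where f' = "\<lambda>f. map f [0..<m]"])
  show "\<forall>w\<in>words b m. map (unroll b m c w) [0..<m] = w"
    using assms by (auto simp: words_def unroll_def subset_iff intro!: nth_equalityI)
  show "\<forall>f\<in>quasi_periodic b m c. unroll b m c (map f [0..<m]) = f"
  proof (intro ballI ext)
    fix f i assume "f \<in> quasi_periodic b m c"
    from quasi_periodic_add_mult[OF this, of "i mod m" "i div m"]
    show "unroll b m c (map f [0..<m]) i = f i"
      using assms by (simp add: unroll_def)
  qed
  show "unroll b m c ` words b m \<subseteq> quasi_periodic b m c"
    using assms by (auto simp: quasi_periodic_def unroll_def mod_simps algebra_simps)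
  show "(\<lambda>f. map f [0..<m]) ` quasi_periodic b m c \<subseteq> words b m"
    by (auto simp: quasi_periodic_def words_def)
qed

lemma card_quasi_periodic:
  assumes "0 < b" "0 < m"
  shows "card (quasi_periodic b m c) = b ^ m"
proof -
  have "card (quasi_periodic b m c) = card (words b m)"
    using bij_betw_same_card[OF bij_betw_unroll[OF assms]] by simp
  then show ?thesis
    using card_lists_length_eq[of "{..<b}" m] by (simp add: words_def conj_commute)
qed

text \<open>
  On sequences \<open>\<iota>\<close> is the plain shift, whose iterates are easy to describe.
\<close>

lemma unroll_incremented_cycling:
  assumes "0 < n" "s \<in> words b n"
  shows "unroll b n 1 (\<iota> b s) i = unroll b n 1 s (Suc i)"
proof -
  obtain x xs where s: "s = x # xs" and len: "n = Suc (length xs)"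
    using assms by (cases s) (auto simp: words_def)
  have "i mod n < n"
    using assms by simp
  \<comment> \<open>The increment enters exactly when \<open>i + 1\<close> wraps around to position \<open>0\<close>.\<close>
  then consider "Suc (i mod n) < n" | "Suc (i mod n) = n"
    by linarith
  then show ?thesis
  proof cases
    case 1
    then show ?thesis
      by (simp add: unroll_def incremented_cycling_def s len nth_append mod_Suc div_Suc)
  next
    case 2
    then have "i mod n = length xs" "Suc i mod n = 0" "Suc i div n = Suc (i div n)"
      by (simp_all add: len mod_Suc div_Suc)
    then show ?thesis
      by (simp add: unroll_def incremented_cycling_def s nth_append mod_add_left_eq)
  qed
qed

lemma incremented_cycling_funpow_in_words:
  assumes "0 < b" "0 < n" "s \<in> words b n"
  shows "(\<iota> b ^^ t) s \<in> words b n"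
  by (induct t) (use assms bij_betw_apply[OF bij_betw_incremented_cycling] in auto)

lemma unroll_incremented_cycling_funpow:
  assumes "0 < b" "0 < n" "s \<in> words b n"
  shows "unroll b n 1 ((\<iota> b ^^ t) s) i = unroll b n 1 s (i + t)"
proof (induct t arbitrary: i)
  case (Suc t)
  then show ?case
    using unroll_incremented_cycling[OF \<open>0 < n\<close> incremented_cycling_funpow_in_words[OF assms]]
    by simp
qed simp


section \<open>Fixed points\<close>

lemma incremented_cycling_funpow_fixes_iff:
  assumes "0 < b" "0 < n" "s \<in> words b n"
  shows "(\<iota> b ^^ t) s = s \<longleftrightarrow> unroll b n 1 s \<in> quasi_periodic b t 0"
proof -
  have "(\<iota> b ^^ t) s = s \<longleftrightarrow> unroll b n 1 ((\<iota> b ^^ t) s) = unroll b n 1 s"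
    using bij_betw_imp_inj_on[OF bij_betw_unroll] incremented_cycling_funpow_in_words assms
    by (metis inj_on_eq_iff)
  also have "\<dots> \<longleftrightarrow> (\<forall>i. unroll b n 1 s (i + t) = unroll b n 1 s i)"
    unfolding fun_eq_iff unroll_incremented_cycling_funpow[OF assms] ..
  also have "\<dots> \<longleftrightarrow> unroll b n 1 s \<in> quasi_periodic b t 0"
    using \<open>0 < b\<close> by (simp add: quasi_periodic_def unroll_def)
  finally show ?thesis .
qed

text \<open>
  The common multiple \<open>n t / g\<close> of both periods is reached by \<open>t / g\<close> steps of increment \<open>1\<close> and by
  \<open>n / g\<close> steps of increment \<open>0\<close>, so \<open>t / g\<close> vanishes modulo \<open>b\<close>.
\<close>

lemma quasi_periodic_two_periods_dvd:
  assumes "0 < n" and f: "f \<in> quasi_periodic b n 1" "f \<in> quasi_periodic b t 0"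
  shows "b * gcd n t dvd t"
proof -
  define g where "g = gcd n t"
  have "0 < g" and t: "t = g * (t div g)" and n: "n = g * (n div g)"
    using \<open>0 < n\<close> by (auto simp: g_def)
  have "n * (t div g) = t * (n div g)"
    by (metis n t mult.assoc mult.commute)
  then have "(f 0 + t div g) mod b = f 0 mod b"
    using quasi_periodic_add_mult[OF f(1), of 0 "t div g"]
      quasi_periodic_add_mult[OF f(2), of 0 "n div g"] by simp
  then have "b dvd t div g"
    using mod_eq_dvd_iff_nat[of "f 0" "f 0 + t div g" b] by simp
  then show ?thesis
    using t by (metis g_def mult.commute mult_dvd_mono dvd_refl)
qed

text \<open>
  The two laws give the single one by walking \<open>x\<close> periods \<open>n\<close> forward and \<open>y\<close> periods \<open>t\<close> back.
  Conversely, \<open>n\<close> consists of \<open>n / g\<close> steps of length \<open>g\<close>, with total increment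
  \<open>x n / g = 1 + y t / g\<close>, and \<open>t\<close> of \<open>t / g\<close> steps; the divisibility assumption makes \<open>t / g\<close> vanish
  modulo \<open>b\<close>.
\<close>

lemma quasi_periodic_two_periods_eq:
  assumes "0 < n" and dvd: "b * gcd n t dvd t" and bezout: "n * x = t * y + gcd n t"
  shows "quasi_periodic b n 1 \<inter> quasi_periodic b t 0 = quasi_periodic b (gcd n t) x"
proof (intro set_eqI iffI)
  fix f assume f: "f \<in> quasi_periodic b n 1 \<inter> quasi_periodic b t 0"
  have "f (i + gcd n t) = (f i + x) mod b" for i
  proof -
    have "f (i + gcd n t) = f (i + gcd n t + t * y)"
      using quasi_periodic_add_mult[of f b t 0 "i + gcd n t" y] f
      by (simp add: quasi_periodic_def)
    also have "i + gcd n t + t * y = i + n * x"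
      using bezout by simp
    also have "f (i + n * x) = (f i + x) mod b"
      using quasi_periodic_add_mult[of f b n 1 i x] f by simp
    finally show ?thesis .
  qed
  with f show "f \<in> quasi_periodic b (gcd n t) x"
    by (simp add: quasi_periodic_def)
next
  fix f assume f: "f \<in> quasi_periodic b (gcd n t) x"
  define g where "g = gcd n t"
  have "0 < g"
    using \<open>0 < n\<close> by (simp add: g_def)
  obtain r where r: "t = b * g * r"
    using dvd by (auto simp: g_def)
  obtain q where q: "n = g * q"
    unfolding g_def by (metis gcd_dvd1 dvdE)
  have "g * (q * x) = g * (b * r * y + 1)"
    using bezout by (fold g_def) (simp add: r q algebra_simps)
  then have "q * x = b * r * y + 1"
    using \<open>0 < g\<close> by (simp only: mult_cancel1) simp
  then have qx: "x * q = 1 + b * (r * y)"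
    by (simp add: ac_simps)
  have "f (i + n) = (f i + 1) mod b" for i
    using quasi_periodic_add_mult[OF f, of i q] by (simp add: qx flip: g_def q add.assoc)
  moreover have "f (i + t) = f i mod b" for i
  proof -
    have "i + t = i + g * (b * r)"
      by (simp add: r)
    then show ?thesis
      using quasi_periodic_add_mult[OF f, folded g_def, of i "b * r"]
      by (simp add: mult.left_commute[of x])
  qed
  ultimately show "f \<in> quasi_periodic b n 1 \<inter> quasi_periodic b t 0"
    using f by (simp add: quasi_periodic_def)
qed

lemma card_fixed_words:
  assumes "0 < b" "0 < n"
  shows "card {s \<in> words b n. (\<iota> b ^^ t) s = s} = (if b * gcd n t dvd t then b ^ gcd n t else 0)"
proof -
  note bij = bij_betw_unroll[OF assms, of 1]
  have "bij_betw (unroll b n 1) {s \<in> words b n. (\<iota> b ^^ t) s = s}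
      (quasi_periodic b n 1 \<inter> quasi_periodic b t 0)"
    unfolding bij_betw_def
  proof
    show "inj_on (unroll b n 1) {s \<in> words b n. (\<iota> b ^^ t) s = s}"
      using bij by (auto simp: bij_betw_def intro: inj_on_subset)
    have "unroll b n 1 ` {s \<in> words b n. (\<iota> b ^^ t) s = s} =
        {f \<in> unroll b n 1 ` words b n. f \<in> quasi_periodic b t 0}"
      using incremented_cycling_funpow_fixes_iff[OF assms] by blast
    then show "unroll b n 1 ` {s \<in> words b n. (\<iota> b ^^ t) s = s} =
        quasi_periodic b n 1 \<inter> quasi_periodic b t 0"
      using bij by (auto simp: bij_betw_def)
  qed
  then have card: "card {s \<in> words b n. (\<iota> b ^^ t) s = s} =
      card (quasi_periodic b n 1 \<inter> quasi_periodic b t 0)"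
    by (rule bij_betw_same_card)
  show ?thesis
  proof (cases "b * gcd n t dvd t")
    case True
    obtain x y where "n * x = t * y + gcd n t"
      using bezout_nat[of n t] \<open>0 < n\<close> by auto
    from quasi_periodic_two_periods_eq[OF \<open>0 < n\<close> True this] show ?thesis
      using True card assms by (simp add: card_quasi_periodic)
  next
    case False
    then have "quasi_periodic b n 1 \<inter> quasi_periodic b t 0 = {}"
      using quasi_periodic_two_periods_dvd[OF \<open>0 < n\<close>] by auto
    with False card show ?thesis
      by simp
  qed
qed


section \<open>Arithmetic of the least codivisor\<close>

lemma least_codivisor_props:
  assumes "0 < n"
  shows "0 < least_codivisor b n" "least_codivisor b n dvd n"
    "coprime (n div least_codivisor b n) b"
proof -
  have "\<exists>d. 0 < d \<and> d dvd n \<and> coprime (n div d) b"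
    using assms by (intro exI[of _ n]) simp
  from LeastI_ex[OF this] show "0 < least_codivisor b n" "least_codivisor b n dvd n"
    "coprime (n div least_codivisor b n) b"
    by (auto simp: least_codivisor_def)
qed

text \<open>
  The quotient \<open>n / gcd d e\<close> is in fact the lcm of \<open>n / d\<close> and \<open>n / e\<close>; the product is enough to pass
  on coprimality to \<open>b\<close>.
\<close>

lemma div_gcd_dvd_mult:
  fixes n d e :: nat
  assumes "0 < n" "d dvd n" "e dvd n"
  shows "n div gcd d e dvd (n div d) * (n div e)"
proof -
  obtain p q where pq: "n = d * p" "n = e * q"
    using assms by (meson dvdE)
  have "n dvd (p * q) * d"
    unfolding pq(1) by (simp add: ac_simps)
  moreover have "n dvd (p * q) * e"
    unfolding pq(2) by (simp add: ac_simps)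
  ultimately have "n dvd (p * q) * gcd d e"
    unfolding gcd_mult_distrib_nat by (rule gcd_greatest)
  moreover have "0 < d" "0 < e"
    using pq \<open>0 < n\<close> by (auto intro: Nat.gr0I)
  moreover have "gcd d e dvd n"
    using \<open>d dvd n\<close> by (rule dvd_trans[OF gcd_dvd1])
  moreover have "n div d = p" "n div e = q"
    using pq \<open>0 < d\<close> \<open>0 < e\<close> by (metis nonzero_mult_div_cancel_left less_numeral_extra(3))+
  ultimately show ?thesis
    by (simp add: div_dvd_iff_mult)
qed

text \<open>
  The divisors of \<open>n\<close> with quotient coprime to \<open>b\<close> are closed under gcd, so the smallest one in size
  is also the smallest with respect to divisibility.
\<close>

lemma least_codivisor_dvd:
  assumes "0 < n" "e dvd n" "coprime (n div e) b"
  shows "least_codivisor b n dvd e"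
proof -
  let ?d = "least_codivisor b n"
  note d = least_codivisor_props[OF \<open>0 < n\<close>, of b]
  have "coprime ((n div ?d) * (n div e)) b"
    using d assms by simp
  then have "coprime (n div gcd ?d e) b"
    using div_gcd_dvd_mult[OF \<open>0 < n\<close> d(2) \<open>e dvd n\<close>] coprime_divisors dvd_refl by blast
  moreover have "0 < gcd ?d e" "gcd ?d e dvd n"
    using d(1) \<open>e dvd n\<close> by (auto intro: dvd_trans)
  ultimately have "?d \<le> gcd ?d e"
    by (subst least_codivisor_def) (auto intro: Least_le)
  then have "gcd ?d e = ?d"
    using d(1) by (simp add: gcd_le1_nat le_antisym)
  then show ?thesis
    by (metis gcd_dvd2)
qed

text \<open>
  Let \<open>g = gcd n t\<close> and \<open>d\<close> the least codivisor.  If \<open>b\<close> divides \<open>t / g\<close>, then it is coprime to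
  \<open>n / g\<close>, since \<open>t / g\<close> is; hence \<open>d\<close> divides \<open>g\<close>.  Conversely, if \<open>t = b d r\<close> and \<open>n = d m\<close> with \<open>m\<close>
  coprime to \<open>b\<close>, then \<open>g = d gcd m r\<close>, and \<open>b g\<close> divides \<open>b d r\<close>.
\<close>

lemma mult_gcd_dvd_iff_least_codivisor:
  assumes "0 < n"
  shows "b * gcd n t dvd t \<longleftrightarrow> b * least_codivisor b n dvd t"
proof
  define g where "g = gcd n t"
  have "0 < g"
    using \<open>0 < n\<close> by (simp add: g_def)
  assume "b * gcd n t dvd t"
  then have bt: "b dvd t div g"
    using \<open>0 < g\<close> by (simp add: g_def dvd_div_iff_mult)
  have "coprime (n div g) (t div g)"
    unfolding g_def using \<open>0 < n\<close> by (intro div_gcd_coprime) simp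
  then have "coprime (n div g) b"
    using bt coprime_divisors dvd_refl by blast
  then have "least_codivisor b n dvd g"
    using \<open>0 < n\<close> by (intro least_codivisor_dvd) (auto simp: g_def)
  then show "b * least_codivisor b n dvd t"
    using \<open>b * gcd n t dvd t\<close> by (metis g_def dvd_trans mult_dvd_mono dvd_refl)
next
  define d where "d = least_codivisor b n"
  note d = least_codivisor_props[OF \<open>0 < n\<close>, of b, folded d_def]
  obtain m where m: "n = d * m"
    using d by (auto simp: dvd_def)
  have "coprime m b"
    using d m by simp
  assume "b * least_codivisor b n dvd t"
  then obtain r where r: "t = d * (b * r)"
    by (metis d_def dvdE mult.assoc mult.commute)
  have "gcd n t = d * gcd m (b * r)"
    unfolding m r by (simp add: gcd_mult_distrib_nat)
  also have "gcd m (b * r) = gcd m r"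
    using \<open>coprime m b\<close> by (simp add: gcd_mult_right_left_cancel)
  finally have "b * gcd n t = d * b * gcd m r"
    by simp
  also have "\<dots> dvd d * b * r"
    by (intro mult_dvd_mono) auto
  finally show "b * gcd n t dvd t"
    by (simp add: r)
qed


section \<open>The number of cycles\<close>

lemma sum_over_gcd:
  fixes F :: "nat \<Rightarrow> real"
  assumes "0 < m"
  shows "(\<Sum>j\<in>{0<..m}. F (gcd m j)) = (\<Sum>e | e dvd m. real (totient (m div e)) * F e)"
proof -
  have "(\<Sum>j\<in>{0<..m}. F (gcd m j)) =
      (\<Sum>e | e dvd m. \<Sum>j | j \<in> {0<..m} \<and> gcd m j = e. F (gcd m j))"
    by (rule sum.group[symmetric]) (use assms in auto)
  also have "\<dots> = (\<Sum>e | e dvd m. real (totient (m div e)) * F e)"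
  proof (rule sum.cong)
    fix e assume "e \<in> {e. e dvd m}"
    then show "(\<Sum>j | j \<in> {0<..m} \<and> gcd m j = e. F (gcd m j)) = real (totient (m div e)) * F e"
      using card_gcd_eq_totient[OF assms, of e] by (simp add: gcd.commute)
  qed simp
  finally show ?thesis .
qed

theorem corollary2:
  fixes b n k :: nat
  assumes "b \<ge> 1" and "n \<ge> 1" and "k \<ge> 1"
  shows "real (card (factor (words b n) k (\<iota> b))) =
    real (k * gcd (lcm k (b * least_codivisor b n)) n) /
    real (lcm k (b * least_codivisor b n) * n) *
    (\<Sum>d | d > 0 \<and> gcd (lcm k (b * least_codivisor b n)) n dvd d \<and> d dvd n.
       real (totient (n div d)) * real b ^ d)"
proof -
  define D where "D = lcm k (b * least_codivisor b n)"
  define h where "h = gcd D n"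
  define m where "m = n div h"
  define N where "N = D * m"
  have pos: "0 < b" "0 < n" "0 < k"
    using assms by auto
  have "0 < D" "0 < h"
    using pos least_codivisor_props(1)[OF pos(2), of b] by (auto simp: D_def h_def lcm_pos_nat)
  have n: "n = h * m"
    by (simp add: h_def m_def)
  with pos have "0 < m"
    by (cases m) auto
  have "0 < N"
    using \<open>0 < D\<close> \<open>0 < m\<close> by (simp add: N_def)
  have "n dvd N"
    unfolding N_def n by (simp add: h_def mult_dvd_mono)
  have fixed: "card {s \<in> words b n. (\<iota> b ^^ t) s = s} =
      (if b * least_codivisor b n dvd t then b ^ gcd n t else 0)" for t
    using card_fixed_words[OF pos(1,2)] mult_gcd_dvd_iff_least_codivisor[OF pos(2)] by simp
  have "b * least_codivisor b n dvd N"
    unfolding N_def D_def by (simp add: dvd_mult2)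
  \<comment> \<open>The fixed-point formula itself shows that \<open>N\<close> is a period: it counts all \<open>b ^ n\<close> words.\<close>
  with \<open>n dvd N\<close> have "card {s \<in> words b n. (\<iota> b ^^ N) s = s} = card (words b n)"
    using fixed[of N] card_quasi_periodic[OF pos(1,2)] bij_betw_same_card[OF bij_betw_unroll[OF pos(1,2)]]
    by (simp add: gcd_nat.absorb1)
  then have period: "(\<iota> b ^^ N) s = s" if "s \<in> words b n" for s
    using card_subset_eq[OF finite_words, of "{s \<in> words b n. (\<iota> b ^^ N) s = s}" b n] that by auto
  have "N * card (factor (words b n) k (\<iota> b)) =
      k * (\<Sum>t | t \<in> {0<..N} \<and> k dvd t. card {s \<in> words b n. (\<iota> b ^^ t) s = s})"
  proof (rule card_factor)
    show "\<iota> b ` words b n \<subseteq> words b n"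
      using bij_betw_incremented_cycling[OF pos(1,2)] by (simp add: bij_betw_def)
    show "k dvd N"
      by (simp add: N_def D_def dvd_mult2)
  qed (use pos \<open>0 < N\<close> finite_words period in auto)
  also have "(\<Sum>t | t \<in> {0<..N} \<and> k dvd t. card {s \<in> words b n. (\<iota> b ^^ t) s = s}) =
      (\<Sum>t | t \<in> {0<..N} \<and> D dvd t. b ^ gcd n t)"
    unfolding fixed by (rule sum.mono_neutral_cong_right) (auto simp: D_def)
  also have "\<dots> = (\<Sum>j\<in>{0<..m}. b ^ gcd n (D * j))"
    unfolding N_def multiples_up_to_eq_image[OF \<open>0 < D\<close>]
    using \<open>0 < D\<close> by (subst sum.reindex) (auto simp: inj_on_def)
  also have "\<dots> = (\<Sum>j\<in>{0<..m}. b ^ (h * gcd m j))"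
  proof (rule sum.cong)
    fix j
    obtain r where r: "D = h * r"
      by (metis h_def gcd_dvd1 dvdE)
    have "h * gcd r m = h * 1"
      using r n by (metis gcd_mult_distrib_nat h_def mult.right_neutral)
    then have "coprime r m"
      using \<open>0 < h\<close> by (simp add: coprime_iff_gcd_eq_1)
    have "gcd n (D * j) = h * gcd m (r * j)"
      unfolding n r by (simp add: gcd_mult_distrib_nat mult.assoc)
    also have "gcd m (r * j) = gcd m j"
      using \<open>coprime r m\<close> by (simp add: gcd_mult_right_left_cancel coprime_commute)
    finally show "b ^ gcd n (D * j) = b ^ (h * gcd m j)"
      by simp
  qed simp
  finally have count: "real N * real (card (factor (words b n) k (\<iota> b))) =
      real k * (\<Sum>j\<in>{0<..m}. real b ^ (h * gcd m j))"
    by (simp flip: of_nat_mult of_nat_power of_nat_sum)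
  have "(\<Sum>j\<in>{0<..m}. real b ^ (h * gcd m j)) =
      (\<Sum>e | e dvd m. real (totient (m div e)) * real b ^ (h * e))"
    by (rule sum_over_gcd[OF \<open>0 < m\<close>])
  also have "\<dots> = (\<Sum>d | d > 0 \<and> h dvd d \<and> d dvd n. real (totient (n div d)) * real b ^ d)"
    by (rule sum.reindex_bij_witness[where i = "\<lambda>d. d div h" and j = "\<lambda>e. h * e"])
      (use \<open>0 < h\<close> \<open>0 < m\<close> in \<open>auto simp: n intro: Nat.gr0I\<close>)
  finally have "real (card (factor (words b n) k (\<iota> b))) = real k / real N *
      (\<Sum>d | d > 0 \<and> h dvd d \<and> d dvd n. real (totient (n div d)) * real b ^ d)"
    using count \<open>0 < N\<close> by (simp add: field_simps)
  also have "real k / real N = real (k * h) / real (D * n)"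
    using \<open>0 < h\<close> by (simp add: N_def n)
  finally show ?thesis
    by (simp add: D_def h_def)
qed

end
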